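(* Let $\Omega \subseteq \mathbb{R}^n$ be a bounded domain. Assume that $u, v \in C(\bar\Omega)$, that $u$ is infinity subharmonic in $\Omega$, and that $v$ is infinity superharmonic in $\Omega$. Then $$\max_{\bar\Omega}(u-v) = \max_{\partial\Omega}(u-v).$$
   Context: A domain is a nonempty connected open set; functions are real-valued. The infinity Laplace equation is $-\Delta_\infty u := -\sum_{i,j=1}^n u_{x_ix_j}u_{x_i}u_{x_j} = 0$. A viscosity subsolution (supersolution) of this equation in $\Omega$ is called infinity subharmonic (superharmonic) in $\Omega$. Explicitly (standard definition): a function $u \in C(\Omega)$ is infinity subharmonic in $\Omega$ if, whenever $\varphi \in C^2(\Omega)$ and $u-\varphi$ has a local maximum at $x_0 \in \Omega$, one has $-\Delta_\infty\varphi(x_0) \le 0$; a function $v \in C(\Omega)$ is infinity superharmonic in $\Omega$ if, whenever $\varphi \in C^2(\Omega)$ and $v-\varphi$ has a local minimum at $x_0 \in \Omega$, one has $-\Delta_\infty\varphi(x_0) \ge 0$. Here $\bar\Omega$ and $\partial\Omega$ denote the closure and boundary of $\Omega$. *)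

theory Defs
  imports "HOL-Analysis.Analysis"
begin

definition is_domain :: "(real ^ 'n) set \<Rightarrow> bool" where
  "is_domain \<Omega> \<longleftrightarrow> open \<Omega> \<and> connected \<Omega> \<and> \<Omega> \<noteq> {}"

definition partial_differentiable :: "(real ^ 'n \<Rightarrow> real) \<Rightarrow> 'n \<Rightarrow> real ^ 'n \<Rightarrow> bool" where
  "partial_differentiable f i x \<longleftrightarrow>
     (\<lambda>t. f (x + t *\<^sub>R axis i 1)) field_differentiable (at 0)"

definition partial_deriv :: "'n \<Rightarrow> (real ^ 'n \<Rightarrow> real) \<Rightarrow> real ^ 'n \<Rightarrow> real" where
  "partial_deriv i f x = deriv (\<lambda>t. f (x + t *\<^sub>R axis i 1)) 0"

(* For open S; the partial derivatives at points of S then depend only on the values on S. *)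
definition C1_on :: "(real ^ 'n) set \<Rightarrow> (real ^ 'n \<Rightarrow> real) \<Rightarrow> bool" where
  "C1_on S f \<longleftrightarrow> continuous_on S f \<and>
     (\<forall>i. (\<forall>x\<in>S. partial_differentiable f i x) \<and> continuous_on S (partial_deriv i f))"

definition C2_on :: "(real ^ 'n) set \<Rightarrow> (real ^ 'n \<Rightarrow> real) \<Rightarrow> bool" where
  "C2_on S f \<longleftrightarrow> C1_on S f \<and> (\<forall>i. C1_on S (partial_deriv i f))"

definition infinity_laplacian :: "(real ^ 'n \<Rightarrow> real) \<Rightarrow> real ^ 'n \<Rightarrow> real" where
  "infinity_laplacian f x =
     (\<Sum>i\<in>UNIV. \<Sum>j\<in>UNIV.
        partial_deriv j (partial_deriv i f) x * partial_deriv i f x * partial_deriv j f x)"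

definition local_max_at :: "'a::metric_space set \<Rightarrow> ('a \<Rightarrow> real) \<Rightarrow> 'a \<Rightarrow> bool" where
  "local_max_at S f x0 \<longleftrightarrow> x0 \<in> S \<and> (\<exists>e>0. \<forall>x\<in>S \<inter> ball x0 e. f x \<le> f x0)"

definition local_min_at :: "'a::metric_space set \<Rightarrow> ('a \<Rightarrow> real) \<Rightarrow> 'a \<Rightarrow> bool" where
  "local_min_at S f x0 \<longleftrightarrow> x0 \<in> S \<and> (\<exists>e>0. \<forall>x\<in>S \<inter> ball x0 e. f x0 \<le> f x)"

definition infinity_subharmonic_on ::
    "(real ^ 'n) set \<Rightarrow> (real ^ 'n \<Rightarrow> real) \<Rightarrow> bool" where
  "infinity_subharmonic_on \<Omega> u \<longleftrightarrow> continuous_on \<Omega> u \<and>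
     (\<forall>\<phi> x0. C2_on \<Omega> \<phi> \<longrightarrow> local_max_at \<Omega> (\<lambda>x. u x - \<phi> x) x0 \<longrightarrow>
        - infinity_laplacian \<phi> x0 \<le> 0)"

definition infinity_superharmonic_on ::
    "(real ^ 'n) set \<Rightarrow> (real ^ 'n \<Rightarrow> real) \<Rightarrow> bool" where
  "infinity_superharmonic_on \<Omega> v \<longleftrightarrow> continuous_on \<Omega> v \<and>
     (\<forall>\<phi> x0. C2_on \<Omega> \<phi> \<longrightarrow> local_min_at \<Omega> (\<lambda>x. v x - \<phi> x) x0 \<longrightarrow>
        - infinity_laplacian \<phi> x0 \<ge> 0)"

(* "max over S of f exists and equals m".  A relation rather than a function, because Max is
   meaningful only for finite sets and Sup does not express that the value is attained. *)
definition is_max_on :: "'a set \<Rightarrow> ('a \<Rightarrow> real) \<Rightarrow> real \<Rightarrow> bool" where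
  "is_max_on S f m \<longleftrightarrow> m \<in> f ` S \<and> (\<forall>x\<in>S. f x \<le> m)"

end

theory Submission
  imports Defs "HOL-Computational_Algebra.Polynomial"
begin

text \<open>
  This is Jensen's comparison theorem, by the argument of Armstrong and Smart, which replaces the
  equation by a finite difference inequality and so avoids both the theorem on sums and
  approximation by other equations.

  Put \<open>w = - v\<close>. Both \<open>u\<close> and \<open>w\<close> are infinity subharmonic, and only the viscosity inequality for
  radial test functions is used. It yields comparison with cones (\<open>comparison_with_cones\<close>): on a
  ball around \<open>x\<^sub>0\<close>, a subharmonic function lies below the cone with vertex value \<open>u x\<^sub>0\<close> whose value
  on the bounding sphere is the maximum of \<open>u\<close> over the ball. Evaluated halfway to the sphere, this
  says that the supremum \<open>U x\<close> of \<open>u\<close> over the ball of radius \<open>r\<close> around \<open>x\<close> is at most the mean of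
  \<open>u x\<close> and the maximum of \<open>u\<close> over the ball of radius \<open>2 r\<close>. Hence \<open>2 U x \<le> min U + max U\<close>, with
  minimum and maximum taken over the ball of radius \<open>r\<close> around \<open>x\<close>
  (\<open>discretely_subharmonic_sup_ball\<close>). The supremum \<open>W\<close> of \<open>w\<close> over balls behaves in the same way.

  For two functions with this discrete property, the set where \<open>U + W\<close> is maximal and, on
  that set, \<open>U\<close> is as large as possible would contain the \<open>r\<close>-ball around each of its points, so it
  would be open and compact. Hence \<open>U + W\<close> has a maximum point at which the discrete property, or
  the room for it, fails (\<open>discrete_maximum_principle\<close>). If the maximum of \<open>u - v = u + w\<close> over the
  closure exceeded the one over the boundary, then for small \<open>r\<close>, by uniform continuity, every
  maximum point of \<open>U + W\<close> would have distance more than \<open>2 r\<close> from the boundary, where nothing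
  fails.
\<close>

section \<open>Radial polynomials as test functions\<close>

lemma norm_diff_plus_axis_squared:
  fixes x y :: "real ^ 'n"
  shows "(norm (x + t *\<^sub>R axis i 1 - y))\<^sup>2 = (norm (x - y))\<^sup>2 + 2 * t * (x $ i - y $ i) + t\<^sup>2"
proof -
  have "(norm (x + t *\<^sub>R axis i 1 - y))\<^sup>2 = (norm ((x - y) + t *\<^sub>R axis i 1))\<^sup>2"
    by (simp only: diff_add_eq)
  also have "\<dots> = (norm (x - y))\<^sup>2 + 2 * ((x - y) \<bullet> (t *\<^sub>R axis i 1)) + (norm (t *\<^sub>R axis i 1 :: real ^ 'n))\<^sup>2"
    unfolding power2_norm_eq_inner by (simp add: inner_add_left inner_add_right inner_commute)
  finally show ?thesis by (simp add: inner_axis)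
qed

lemma DERIV_radial_poly_along_axis:
  fixes x y :: "real ^ 'n"
  shows "((\<lambda>t. poly p ((norm (x + t *\<^sub>R axis i 1 - y))\<^sup>2)) has_field_derivative
          2 * poly (pderiv p) ((norm (x - y))\<^sup>2) * (x $ i - y $ i)) (at 0)"
  unfolding norm_diff_plus_axis_squared
  by (auto intro!: derivative_eq_intros DERIV_chain2[OF poly_DERIV])

lemma DERIV_radial_poly_mult_component_along_axis:
  fixes x y :: "real ^ 'n"
  shows "((\<lambda>t. 2 * poly p ((norm (x + t *\<^sub>R axis j 1 - y))\<^sup>2) * ((x + t *\<^sub>R axis j 1) $ i - y $ i))
          has_field_derivative
          4 * poly (pderiv p) ((norm (x - y))\<^sup>2) * (x $ i - y $ i) * (x $ j - y $ j)
          + 2 * poly p ((norm (x - y))\<^sup>2) * (if i = j then 1 else 0)) (at 0)"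
proof -
  have "((\<lambda>t. (x + t *\<^sub>R axis j 1) $ i - y $ i) has_field_derivative (if i = j then 1 else 0)) (at 0)"
    by (auto simp: axis_def intro!: derivative_eq_intros)
  note d = DERIV_mult[OF DERIV_cmult[OF DERIV_radial_poly_along_axis, of 2] this]
  show ?thesis
    by (rule DERIV_cong[OF d]) (simp add: algebra_simps)
qed

lemma partial_deriv_radial_poly:
  fixes y :: "real ^ 'n"
  shows "partial_deriv i (\<lambda>x. poly p ((norm (x - y))\<^sup>2))
       = (\<lambda>x. 2 * poly (pderiv p) ((norm (x - y))\<^sup>2) * (x $ i - y $ i))"
  unfolding partial_deriv_def by (intro ext DERIV_imp_deriv DERIV_radial_poly_along_axis)

lemma partial_deriv_radial_poly_mult_component:
  fixes y :: "real ^ 'n"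
  shows "partial_deriv j (\<lambda>x. 2 * poly p ((norm (x - y))\<^sup>2) * (x $ i - y $ i))
       = (\<lambda>x. 4 * poly (pderiv p) ((norm (x - y))\<^sup>2) * (x $ i - y $ i) * (x $ j - y $ j)
          + 2 * poly p ((norm (x - y))\<^sup>2) * (if i = j then 1 else 0))"
  unfolding partial_deriv_def by (intro ext DERIV_imp_deriv DERIV_radial_poly_mult_component_along_axis)

lemma C2_on_radial_poly:
  fixes y :: "real ^ 'n"
  shows "C2_on S (\<lambda>x. poly p ((norm (x - y))\<^sup>2))"
  unfolding C2_on_def C1_on_def partial_deriv_radial_poly partial_deriv_radial_poly_mult_component
    partial_differentiable_def field_differentiable_def
  using DERIV_radial_poly_along_axis DERIV_radial_poly_mult_component_along_axis
  by (intro conjI allI ballI continuous_intros) blast+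

lemma infinity_laplacian_radial_poly:
  fixes x y :: "real ^ 'n"
  defines "s \<equiv> (norm (x - y))\<^sup>2"
  shows "infinity_laplacian (\<lambda>x. poly p ((norm (x - y))\<^sup>2)) x
       = 8 * (poly (pderiv p) s)\<^sup>2 * s * (2 * poly (pderiv (pderiv p)) s * s + poly (pderiv p) s)"
proof -
  define d where "d i = x $ i - y $ i" for i
  define a where "a = poly (pderiv p) s"
  define b where "b = poly (pderiv (pderiv p)) s"
  have s: "s = (\<Sum>i\<in>UNIV. (d i)\<^sup>2)"
    by (simp add: s_def d_def norm_vec_def L2_set_def sum_nonneg)
  have "infinity_laplacian (\<lambda>x. poly p ((norm (x - y))\<^sup>2)) x
      = (\<Sum>i\<in>UNIV. \<Sum>j\<in>UNIV. (4 * b * d i * d j + 2 * a * (if i = j then 1 else 0))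
           * (2 * a * d i) * (2 * a * d j))"
    unfolding infinity_laplacian_def partial_deriv_radial_poly
      partial_deriv_radial_poly_mult_component a_def b_def d_def s_def ..
  also have "\<dots> = (\<Sum>i\<in>UNIV. \<Sum>j\<in>UNIV. 16 * a\<^sup>2 * b * ((d i)\<^sup>2 * (d j)\<^sup>2)
           + (if i = j then 8 * a ^ 3 * (d j)\<^sup>2 else 0))"
    by (intro sum.cong refl) (auto simp: algebra_simps power2_eq_square power3_eq_cube)
  also have "\<dots> = 16 * a\<^sup>2 * b * (s * s) + 8 * a ^ 3 * s"
    by (simp add: sum.distrib s sum_product flip: sum_distrib_left)
  also have "\<dots> = 8 * a\<^sup>2 * s * (2 * b * s + a)"
    by (simp add: algebra_simps power2_eq_square power3_eq_cube)
  finally show ?thesis by (simp add: a_def b_def)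
qed

text \<open>
  A global polynomial in the squared distance is smooth on all of \<open>\<Omega>\<close>, including at the centre \<open>y\<close>, so
  no cut-off is needed to use it as a test function. The class of these functions is closed under
  negation, which makes \<open>- v\<close> satisfy the same condition as \<open>u\<close> without a discussion of
  derivatives of arbitrary test functions.
\<close>

definition radially_subharmonic_on :: "(real ^ 'n) set \<Rightarrow> (real ^ 'n \<Rightarrow> real) \<Rightarrow> bool" where
  "radially_subharmonic_on \<Omega> u \<longleftrightarrow>
     (\<forall>p y x0. local_max_at \<Omega> (\<lambda>x. u x - poly p ((norm (x - y))\<^sup>2)) x0 \<longrightarrow>
        0 \<le> infinity_laplacian (\<lambda>x. poly p ((norm (x - y))\<^sup>2)) x0)"

lemma subharmonic_imp_radially_subharmonic:
  "infinity_subharmonic_on \<Omega> u \<Longrightarrow> radially_subharmonic_on \<Omega> u"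
  unfolding infinity_subharmonic_on_def radially_subharmonic_on_def
  using C2_on_radial_poly by fastforce

lemma superharmonic_imp_radially_subharmonic_uminus:
  fixes v :: "real ^ 'n \<Rightarrow> real"
  assumes "infinity_superharmonic_on \<Omega> v"
  shows "radially_subharmonic_on \<Omega> (\<lambda>x. - v x)"
  unfolding radially_subharmonic_on_def
proof (intro allI impI)
  fix p and y x0 :: "real ^ 'n"
  assume "local_max_at \<Omega> (\<lambda>x. - v x - poly p ((norm (x - y))\<^sup>2)) x0"
  then have "local_min_at \<Omega> (\<lambda>x. v x - poly (- p) ((norm (x - y))\<^sup>2)) x0"
    unfolding local_max_at_def local_min_at_def by (force simp: algebra_simps)
  then have "infinity_laplacian (\<lambda>x. poly (- p) ((norm (x - y))\<^sup>2)) x0 \<le> 0"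
    using assms C2_on_radial_poly[of \<Omega> "- p" y] unfolding infinity_superharmonic_on_def by fastforce
  moreover have "infinity_laplacian (\<lambda>x. poly (- p) ((norm (x - y))\<^sup>2)) x0
      = - infinity_laplacian (\<lambda>x. poly p ((norm (x - y))\<^sup>2)) x0"
    unfolding infinity_laplacian_radial_poly[of "- p"] infinity_laplacian_radial_poly[of p]
    by (simp add: pderiv_minus algebra_simps)
  ultimately show "0 \<le> infinity_laplacian (\<lambda>x. poly p ((norm (x - y))\<^sup>2)) x0" by simp
qed

section \<open>Comparison with cones\<close>

text \<open>
  With \<open>t = \<rho>\<^sup>2 - 1\<close>, the right-hand side is 16 times the third Taylor polynomial
  \<open>1 + t / 2 - t\<^sup>2 / 8 + t\<^sup>3 / 16\<close> of \<open>sqrt (1 + t) = \<rho>\<close> at \<open>t = 0\<close>. It is a polynomial in \<open>\<rho>\<^sup>2\<close> that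
  majorizes \<open>\<rho>\<close> and agrees with it to third order at \<open>\<rho> = 1\<close>.
\<close>

lemma sextic_majorant_of_radius:
  fixes \<rho> :: real
  assumes "\<rho> \<ge> 0"
  shows "16 * \<rho> \<le> 5 + 15 * \<rho>\<^sup>2 - 5 * \<rho> ^ 4 + \<rho> ^ 6"
proof -
  have "0 \<le> (\<rho> - 1) ^ 4 * (\<rho>\<^sup>2 + 4 * \<rho> + 5)"
    using assms by (intro mult_nonneg_nonneg) auto
  also have "\<dots> = 5 + 15 * \<rho>\<^sup>2 - 5 * \<rho> ^ 4 + \<rho> ^ 6 - 16 * \<rho>" by algebra
  finally show ?thesis by simp
qed

text \<open>
  The function \<open>b s - \<gamma> s\<^sup>2\<close> of the distance \<open>s\<close> from \<open>x0\<close> is a strict supersolution away from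
  \<open>x0\<close> wherever its slope \<open>b - 2 \<gamma> s\<close> is nonzero, because it is strictly concave: the infinity
  Laplacian of a radial function \<open>g s\<close> is \<open>g'' g'\<^sup>2\<close>. Since it is not differentiable at \<open>x0\<close>, the
  distance is replaced by the sextic majorant scaled to touch it at \<open>x1\<close>. A local maximum of \<open>u\<close> minus the
  original function is then one of \<open>u\<close> minus the majorant, and both have the same second order
  derivatives at \<open>x1\<close>.
\<close>

lemma no_local_max_minus_concave_cone:
  fixes u :: "real ^ 'n \<Rightarrow> real"
  assumes u: "radially_subharmonic_on \<Omega> u"
    and b: "b \<ge> 0" and \<gamma>: "\<gamma> > 0" and x1: "x1 \<noteq> x0" and slope: "b \<noteq> 2 * \<gamma> * norm (x1 - x0)"
  shows "\<not> local_max_at \<Omega> (\<lambda>x. u x - (b * norm (x - x0) - \<gamma> * (norm (x - x0))\<^sup>2)) x1"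
proof
  define h where "h x = b * norm (x - x0) - \<gamma> * (norm (x - x0))\<^sup>2" for x
  define R where "R = norm (x1 - x0)"
  have R: "R > 0" using x1 by (simp add: R_def)
  define p where "p = [:5 * b * R / 16, 15 * b / (16 * R) - \<gamma>, - 5 * b / (16 * R ^ 3), b / (16 * R ^ 5):]"
  define \<phi> where "\<phi> x = poly p ((norm (x - x0))\<^sup>2)" for x
  have \<phi>: "\<phi> x = b * R * (5 + 15 * \<rho>\<^sup>2 - 5 * \<rho> ^ 4 + \<rho> ^ 6) / 16 - \<gamma> * (norm (x - x0))\<^sup>2"
    if "\<rho> = norm (x - x0) / R" for x \<rho>
  proof -
    have "norm (x - x0) = R * \<rho>" using R that by simp
    then show ?thesis using R by (simp add: \<phi>_def p_def field_simps power_numeral_reduce)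
  qed
  have above: "h x \<le> \<phi> x" for x
  proof -
    define \<rho> where "\<rho> = norm (x - x0) / R"
    have "b * R * (16 * \<rho>) \<le> b * R * (5 + 15 * \<rho>\<^sup>2 - 5 * \<rho> ^ 4 + \<rho> ^ 6)"
      using sextic_majorant_of_radius[of \<rho>] b R by (intro mult_left_mono) (auto simp: \<rho>_def)
    then show ?thesis using R by (simp add: h_def \<phi>[OF \<rho>_def]) (simp add: \<rho>_def)
  qed
  have touch: "h x1 = \<phi> x1" using R by (simp add: h_def \<phi>[OF refl] R_def[symmetric])
  assume "local_max_at \<Omega> (\<lambda>x. u x - (b * norm (x - x0) - \<gamma> * (norm (x - x0))\<^sup>2)) x1"
  then have "local_max_at \<Omega> (\<lambda>x. u x - h x) x1" by (simp add: h_def)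
  then obtain e where e: "x1 \<in> \<Omega>" "e > 0" "\<And>x. x \<in> \<Omega> \<inter> ball x1 e \<Longrightarrow> u x - h x \<le> u x1 - h x1"
    unfolding local_max_at_def by blast
  have "u x - \<phi> x \<le> u x1 - \<phi> x1" if "x \<in> \<Omega> \<inter> ball x1 e" for x
    using e(3)[OF that] above[of x] touch by linarith
  then have "local_max_at \<Omega> (\<lambda>x. u x - \<phi> x) x1"
    unfolding local_max_at_def using e(1,2) by blast
  then have "0 \<le> infinity_laplacian \<phi> x1"
    using u unfolding radially_subharmonic_on_def \<phi>_def by blast
  then have nonneg: "0 \<le> 8 * (poly (pderiv p) (R\<^sup>2))\<^sup>2 * R\<^sup>2
      * (2 * poly (pderiv (pderiv p)) (R\<^sup>2) * R\<^sup>2 + poly (pderiv p) (R\<^sup>2))"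
    unfolding \<phi>_def infinity_laplacian_radial_poly R_def[symmetric] .
  have p': "poly (pderiv p) (R\<^sup>2) = b / (2 * R) - \<gamma>"
    using R by (simp add: p_def pderiv_pCons field_simps power_numeral_reduce)
  have p'': "poly (pderiv (pderiv p)) (R\<^sup>2) = - b / (4 * R ^ 3)"
    using R by (simp add: p_def pderiv_pCons field_simps power_numeral_reduce)
  have L: "2 * poly (pderiv (pderiv p)) (R\<^sup>2) * R\<^sup>2 + poly (pderiv p) (R\<^sup>2) = - \<gamma>"
    unfolding p' p'' using R by (simp add: field_simps power_numeral_reduce)
  have "0 \<le> 8 * (b / (2 * R) - \<gamma>)\<^sup>2 * R\<^sup>2 * (- \<gamma>)"
    using nonneg[unfolded L] unfolding p' .
  moreover have "b / (2 * R) - \<gamma> \<noteq> 0" using slope R by (simp add: field_simps R_def[symmetric])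
  then have "0 < 8 * (b / (2 * R) - \<gamma>)\<^sup>2 * R\<^sup>2 * \<gamma>" using R \<gamma> by simp
  ultimately show False by simp
qed

text \<open>
  If \<open>u\<close> exceeded the cone at \<open>w\<close>, it would still exceed there the slightly larger function
  \<open>u x0 + b s + \<gamma> s (R - s)\<close> of the distance \<open>s\<close> from \<open>x0\<close>. That function is at least \<open>u\<close> at the
  centre and on the sphere, so the difference would have an interior maximum away from \<open>x0\<close>.
\<close>

lemma comparison_with_cones:
  fixes u :: "real ^ 'n \<Rightarrow> real"
  assumes u: "radially_subharmonic_on \<Omega> u" and cont: "continuous_on (cball x0 R) u"
    and sub: "cball x0 R \<subseteq> \<Omega>" and R: "R > 0"
    and M: "\<And>x. x \<in> cball x0 R \<Longrightarrow> u x \<le> M" and w: "w \<in> cball x0 R"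
  shows "u w \<le> u x0 + (M - u x0) / R * norm (w - x0)"
proof (rule ccontr)
  assume "\<not> ?thesis"
  define b where "b = (M - u x0) / R"
  with \<open>\<not> ?thesis\<close> have gap: "u x0 + b * norm (w - x0) < u w" by simp
  have bR: "b * R = M - u x0" using R by (simp add: b_def)
  have "b \<ge> 0" using M[of x0] R by (simp add: b_def)
  moreover have "b \<noteq> 0" using gap M[OF w] bR by auto
  ultimately have b: "b > 0" by simp
  define \<delta> where "\<delta> = u w - (u x0 + b * norm (w - x0))"
  \<comment> \<open>The first bound keeps the slope \<open>b + \<gamma> (R - 2 s)\<close> positive, the second keeps the strict gap
     at \<open>w\<close>, since \<open>s (R - s) \<le> R\<^sup>2\<close>.\<close>
  define \<gamma> where "\<gamma> = min (b / (2 * R)) (\<delta> / (2 * R\<^sup>2))"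
  have \<delta>: "\<delta> > 0" using gap by (simp add: \<delta>_def)
  have \<gamma>: "\<gamma> > 0" using b \<delta> R by (simp add: \<gamma>_def)
  have "\<gamma> \<le> b / (2 * R)" by (simp add: \<gamma>_def)
  then have \<gamma>b: "\<gamma> * R < b" using R b by (simp add: field_simps)
  have "\<gamma> \<le> \<delta> / (2 * R\<^sup>2)" by (simp add: \<gamma>_def)
  then have \<gamma>\<delta>: "\<gamma> * R\<^sup>2 < \<delta>" using R \<delta> by (simp add: field_simps)
  define B where "B = b + \<gamma> * R"
  define g where "g x = u x - (B * norm (x - x0) - \<gamma> * (norm (x - x0))\<^sup>2)" for x
  have "continuous_on (cball x0 R) g" unfolding g_def by (intro continuous_intros cont)
  then obtain x1 where x1: "x1 \<in> cball x0 R" "\<And>x. x \<in> cball x0 R \<Longrightarrow> g x \<le> g x1"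
    using continuous_attains_sup[of "cball x0 R" g] R by auto
  have "\<gamma> * R * norm (w - x0) \<le> \<gamma> * R * R"
    using w R \<gamma> by (intro mult_left_mono) (auto simp: dist_norm norm_minus_commute)
  moreover have "0 \<le> \<gamma> * (norm (w - x0))\<^sup>2" using \<gamma> by simp
  ultimately have "u x0 < g w" using \<gamma>\<delta>
    by (simp add: g_def B_def \<delta>_def algebra_simps power2_eq_square)
  with x1(2)[OF w] have above: "u x0 < g x1" by simp
  have ne: "x1 \<noteq> x0" using above by (auto simp: g_def)
  have "norm (x1 - x0) \<noteq> R"
  proof
    assume eq: "norm (x1 - x0) = R"
    have "g x1 = u x1 - b * R" by (simp add: g_def eq B_def algebra_simps power2_eq_square)
    then show False using above bR M[OF x1(1)] by simp
  qed
  then have lt: "norm (x1 - x0) < R" using x1(1) by (auto simp: dist_norm norm_minus_commute)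
  then have "x1 \<in> ball x0 R" by (simp add: dist_norm norm_minus_commute)
  then obtain e where e: "e > 0" "ball x1 e \<subseteq> ball x0 R"
    using openE[OF open_ball] by blast
  then have "local_max_at \<Omega> g x1"
    unfolding local_max_at_def using x1 sub ball_subset_cball by blast
  moreover have "B \<noteq> 2 * \<gamma> * norm (x1 - x0)"
  proof -
    have "\<gamma> * norm (x1 - x0) < \<gamma> * R" using \<gamma> lt by simp
    then show ?thesis using \<gamma>b by (simp add: B_def)
  qed
  moreover have "B \<ge> 0" using b \<gamma> R by (simp add: B_def)
  ultimately show False
    using no_local_max_minus_concave_cone[OF u _ \<gamma> ne] unfolding g_def by blast
qed

section \<open>Maxima over balls\<close>

definition sup_ball :: "real \<Rightarrow> ('a::metric_space \<Rightarrow> real) \<Rightarrow> 'a \<Rightarrow> real" where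
  "sup_ball r f x = Sup (f ` cball x r)"

lemma sup_ball_attained:
  fixes f :: "'a::heine_borel \<Rightarrow> real"
  assumes "continuous_on (cball x r) f" and "r \<ge> 0"
  obtains z where "z \<in> cball x r" "sup_ball r f x = f z" "\<And>y. y \<in> cball x r \<Longrightarrow> f y \<le> f z"
proof -
  obtain z where z: "z \<in> cball x r" "\<And>y. y \<in> cball x r \<Longrightarrow> f y \<le> f z"
    using continuous_attains_sup[OF compact_cball _ assms(1)] assms(2) by auto
  then have "sup_ball r f x = f z"
    unfolding sup_ball_def by (intro cSup_eq_maximum) auto
  with z that show ?thesis by blast
qed

lemma le_sup_ball:
  fixes f :: "'a::heine_borel \<Rightarrow> real"
  assumes "continuous_on (cball x r) f" and "y \<in> cball x r"
  shows "f y \<le> sup_ball r f x"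
proof -
  have "r \<ge> 0" using assms(2) zero_le_dist[of x y] by (simp del: zero_le_dist)
  then show ?thesis using sup_ball_attained[OF assms(1)] assms(2) by metis
qed

lemma continuous_on_sup_ball:
  fixes f :: "'a::euclidean_space \<Rightarrow> real"
  assumes f: "continuous_on K f" and K: "compact K" and r: "r \<ge> 0"
  shows "continuous_on {x. cball x r \<subseteq> K} (sup_ball r f)"
proof -
  have le: "sup_ball r f x \<le> sup_ball r f y + e"
    if xK: "cball x r \<subseteq> K" and yK: "cball y r \<subseteq> K" and xy: "dist x y < d"
      and d: "\<And>a b. a \<in> K \<Longrightarrow> b \<in> K \<Longrightarrow> dist b a < d \<Longrightarrow> dist (f b) (f a) < e" for x y d e
  proof -
    obtain z where z: "z \<in> cball x r" "sup_ball r f x = f z"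
      using sup_ball_attained[OF continuous_on_subset[OF f xK] r] by metis
    have z': "z + (y - x) \<in> cball y r" using z(1) by (simp add: dist_norm norm_minus_commute)
    have "dist (f z) (f (z + (y - x))) < e"
      using xK yK xy z(1) z' by (intro d) (auto simp: dist_norm norm_minus_commute)
    moreover have "f (z + (y - x)) \<le> sup_ball r f y"
      using le_sup_ball[OF continuous_on_subset[OF f yK] z'] .
    ultimately show ?thesis by (simp add: z(2) dist_real_def)
  qed
  show ?thesis
    unfolding continuous_on_iff
  proof (intro ballI allI impI)
    fix x and e :: real
    assume x: "x \<in> {x. cball x r \<subseteq> K}" and "e > 0"
    then have "e / 2 > 0" by simp
    then obtain d where d: "d > 0"
      "\<And>a b. a \<in> K \<Longrightarrow> b \<in> K \<Longrightarrow> dist b a < d \<Longrightarrow> dist (f b) (f a) < e / 2"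
      using compact_uniformly_continuous[OF f K] unfolding uniformly_continuous_on_def by metis
    have "dist (sup_ball r f y) (sup_ball r f x) < e" if "cball y r \<subseteq> K" "dist y x < d" for y
      using le[of x y d "e / 2"] le[of y x d "e / 2"] that x d(2) \<open>e > 0\<close>
      by (auto simp: dist_real_def dist_commute)
    then show "\<exists>d>0. \<forall>y\<in>{x. cball x r \<subseteq> K}. dist y x < d \<longrightarrow> dist (sup_ball r f y) (sup_ball r f x) < e"
      using d(1) by blast
  qed
qed

lemma compact_inner_parallel_set:
  fixes K :: "'a::euclidean_space set"
  assumes "compact K" and "r \<ge> 0"
  shows "compact {x. cball x r \<subseteq> K}"
proof -
  have "{x. cball x r \<subseteq> K} = (\<Inter>e\<in>cball 0 r. (\<lambda>x. x + e) -` K)"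
  proof (intro equalityI subsetI)
    fix x assume "x \<in> {x. cball x r \<subseteq> K}"
    then show "x \<in> (\<Inter>e\<in>cball 0 r. (\<lambda>x. x + e) -` K)" by (auto simp: subset_iff dist_norm)
  next
    fix x assume *: "x \<in> (\<Inter>e\<in>cball 0 r. (\<lambda>x. x + e) -` K)"
    have "y \<in> K" if "y \<in> cball x r" for y
    proof -
      have "y - x \<in> cball 0 r" using that by (simp add: dist_norm norm_minus_commute)
      with * have "x + (y - x) \<in> K" by blast
      then show ?thesis by simp
    qed
    then show "x \<in> {x. cball x r \<subseteq> K}" by blast
  qed
  moreover have "closed (\<Inter>e\<in>cball 0 r. (\<lambda>x. x + e) -` K)"
    using compact_imp_closed[OF assms(1)]
    by (intro closed_INT ballI closed_vimage continuous_intros) auto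
  moreover have "{x. cball x r \<subseteq> K} \<subseteq> K" using assms(2) by auto
  ultimately show ?thesis
    using assms(1) by (metis bounded_subset compact_eq_bounded_closed)
qed

text \<open>
  This says \<open>2 f x \<le> min f + max f\<close> over the ball, the finite difference form of
  \<open>- \<Delta>\<^sub>\<infinity> f \<le> 0\<close>: the largest increase over distance \<open>r\<close> is at least the largest decrease.
\<close>

definition discretely_subharmonic_at :: "real \<Rightarrow> ('a::metric_space \<Rightarrow> real) \<Rightarrow> 'a \<Rightarrow> bool" where
  "discretely_subharmonic_at r f x \<longleftrightarrow> (\<exists>z\<in>cball x r. \<forall>y\<in>cball x r. 2 * f x \<le> f y + f z)"

text \<open>
  With \<open>m\<close> a maximum point of \<open>u\<close> in the ball of radius \<open>2 r\<close>, comparison with cones bounds \<open>u\<close> on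
  the ball of radius \<open>r\<close> by \<open>(u x + u m) / 2\<close>. The midpoint of \<open>x\<close> and \<open>m\<close> serves as the
  witness, since its \<open>r\<close>-ball contains \<open>m\<close>; and the \<open>r\<close>-ball of every competitor \<open>y\<close> contains \<open>x\<close>.
\<close>

lemma discretely_subharmonic_sup_ball:
  fixes u :: "real ^ 'n \<Rightarrow> real"
  assumes u: "radially_subharmonic_on \<Omega> u" and cont: "continuous_on \<Omega> u"
    and sub: "cball x (2 * r) \<subseteq> \<Omega>" and r: "r > 0"
  shows "discretely_subharmonic_at r (sup_ball r u) x"
proof -
  have c2: "continuous_on (cball x (2 * r)) u" using cont sub continuous_on_subset by blast
  have sub': "cball z r \<subseteq> cball x (2 * r)" if "z \<in> cball x r" for z
    using that cball_trans by fastforce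
  have c1: "continuous_on (cball z r) u" if "z \<in> cball x r" for z
    using c2 continuous_on_subset sub'[OF that] by blast
  obtain a where a: "a \<in> cball x r" "sup_ball r u x = u a"
    using sup_ball_attained[OF c1[of x]] r by (metis centre_in_cball less_imp_le)
  obtain m where m: "m \<in> cball x (2 * r)" "\<And>y. y \<in> cball x (2 * r) \<Longrightarrow> u y \<le> u m"
    using sup_ball_attained[OF c2] r by (metis less_imp_le mult_pos_pos zero_less_numeral)
  have "u a \<le> u x + (u m - u x) / (2 * r) * norm (a - x)"
    using comparison_with_cones[OF u c2 sub] m(2) sub'[of x] a(1) r by auto
  also have "\<dots> \<le> u x + (u m - u x) / (2 * r) * r"
    using m(2)[of x] a(1) r by (intro add_left_mono mult_left_mono) (auto simp: dist_norm norm_minus_commute)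
  also have "\<dots> = (u x + u m) / 2" using r by (simp add: field_simps)
  finally have main: "2 * sup_ball r u x \<le> u x + u m" by (simp add: a)
  define z where "z = midpoint x m"
  have z: "z \<in> cball x r" and "m \<in> cball z r"
    using m(1) by (simp_all add: z_def dist_midpoint)
  then have "u m \<le> sup_ball r u z" using le_sup_ball[OF c1[OF z]] by blast
  moreover have "u x \<le> sup_ball r u y" if "y \<in> cball x r" for y
    using le_sup_ball[OF c1[OF that]] that by (simp add: dist_commute)
  ultimately have "2 * sup_ball r u x \<le> sup_ball r u y + sup_ball r u z" if "y \<in> cball x r" for y
    using main that by fastforce
  then show ?thesis
    unfolding discretely_subharmonic_at_def using z by blast
qed

section \<open>The maximum principle\<close>

text \<open>
  Suppose the conclusion fails, and let \<open>x\<close> maximize \<open>A\<close> among the maximum points of \<open>A + B\<close>. Testing the witness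
  \<open>a\<close> for \<open>A\<close> against the witness \<open>b\<close> for \<open>B\<close> and conversely, and adding, gives
  \<open>2 (A x + B x) \<le> (A a + B a) + (A b + B b)\<close>, so both are maximum points of \<open>A + B\<close>. By the choice
  of \<open>x\<close>, then \<open>A a \<le> A x\<close> and \<open>A b \<le> A x\<close>, and all these inequalities are equalities. Now the
  discrete inequalities say that \<open>A\<close> and \<open>B\<close> are minimal at \<open>x\<close> over the ball; as \<open>A + B\<close> is maximal at \<open>x\<close>, both
  are constant there. Thus the set of such points \<open>x\<close> is open as well as compact, which
  is impossible.
\<close>

lemma discrete_maximum_principle:
  fixes A B :: "'a::euclidean_space \<Rightarrow> real"
  assumes C: "compact C" "C \<noteq> {}" and A: "continuous_on C A" and B: "continuous_on C B"
    and r: "r > 0"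
  shows "\<exists>x\<in>C. (\<forall>y\<in>C. A y + B y \<le> A x + B x) \<and>
     \<not> (cball x r \<subseteq> C \<and> discretely_subharmonic_at r A x \<and> discretely_subharmonic_at r B x)"
proof (rule ccontr)
  assume "\<not> ?thesis"
  then have sub: "cball x r \<subseteq> C" and dA: "discretely_subharmonic_at r A x"
    and dB: "discretely_subharmonic_at r B x"
    if "x \<in> C" "\<And>y. y \<in> C \<Longrightarrow> A y + B y \<le> A x + B x" for x
    using that by blast+
  have cont: "continuous_on C (\<lambda>x. A x + B x)" by (intro continuous_intros A B)
  obtain xm where xm: "xm \<in> C" "\<And>y. y \<in> C \<Longrightarrow> A y + B y \<le> A xm + B xm"
    using continuous_attains_sup[OF C cont] by blast
  define E where "E = {x\<in>C. A x + B x = A xm + B xm}"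
  have "closed E"
    unfolding E_def using continuous_closed_preimage_constant[OF cont compact_imp_closed[OF C(1)]] .
  then have E: "compact E"
    using C(1) by (metis (no_types, lifting) E_def compact_Int_closed inf.absorb_iff2 mem_Collect_eq subsetI)
  have AE: "continuous_on E A" using A by (rule continuous_on_subset) (auto simp: E_def)
  have "xm \<in> E" using xm(1) by (simp add: E_def)
  then obtain xa where xa: "xa \<in> E" "\<And>y. y \<in> E \<Longrightarrow> A y \<le> A xa"
    using continuous_attains_sup[OF E _ AE] by blast
  define F where "F = {x\<in>E. A x = A xa}"
  have "closed F"
    unfolding F_def using continuous_closed_preimage_constant[OF AE compact_imp_closed[OF E]] .
  have "cball x r \<subseteq> F" if x: "x \<in> F" for x
  proof -
    have max: "A y + B y \<le> A x + B x" if "y \<in> C" for y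
      using xm(2)[OF that] x by (auto simp: F_def E_def)
    have xC: "x \<in> C" using x by (auto simp: F_def E_def)
    note sub = sub[OF xC max]
    have EI: "y \<in> E" if "y \<in> cball x r" "A x + B x \<le> A y + B y" for y
      using that sub max[of y] x by (auto simp: F_def E_def)
    have Emax: "A y \<le> A x" if "y \<in> E" for y using xa(2)[OF that] x by (simp add: F_def)
    obtain a where a: "a \<in> cball x r" "\<And>y. y \<in> cball x r \<Longrightarrow> 2 * A x \<le> A y + A a"
      using dA[OF xC max] unfolding discretely_subharmonic_at_def by blast
    obtain b where b: "b \<in> cball x r" "\<And>y. y \<in> cball x r \<Longrightarrow> 2 * B x \<le> B y + B b"
      using dB[OF xC max] unfolding discretely_subharmonic_at_def by blast
    have *: "2 * A x \<le> A b + A a" "2 * B x \<le> B a + B b" using a b by blast+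
    have ab: "A a + B a \<le> A x + B x" "A b + B b \<le> A x + B x" using max sub a(1) b(1) by blast+
    have "a \<in> E" "b \<in> E" using * ab a(1) b(1) by (auto intro!: EI)
    then have "A a \<le> A x" "A b \<le> A x" using Emax by auto
    then have eq: "A a = A x" "B b = B x" using * ab by linarith+
    show ?thesis
    proof
      fix y assume y: "y \<in> cball x r"
      have ge: "A x \<le> A y" "B x \<le> B y" using a(2)[OF y] b(2)[OF y] eq by simp_all
      then have "y \<in> E" using EI[OF y] by simp
      then show "y \<in> F" using Emax[of y] ge x by (auto simp: F_def)
    qed
  qed
  then have "open F" unfolding open_contains_cball using r by blast
  moreover have "F \<noteq> {}" using xa(1) by (auto simp: F_def)
  ultimately have "F = UNIV" using \<open>closed F\<close> clopen by blast
  moreover have "F \<subseteq> C" by (auto simp: F_def E_def)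
  ultimately have "compact (UNIV :: 'a set)" using C(1) by (metis top.extremum_uniqueI)
  then show False using not_compact_UNIV by blast
qed

lemma frontier_point_in_cball:
  fixes \<Omega> :: "'a::real_normed_vector set"
  assumes "open \<Omega>" and x: "x \<in> closure \<Omega>" and "r \<ge> 0" and sub: "\<not> cball x r \<subseteq> \<Omega>"
  obtains p where "p \<in> frontier \<Omega>" "p \<in> cball x r"
proof (cases "x \<in> \<Omega>")
  case True
  have "x \<in> cball x r" using assms(3) by simp
  with True have "cball x r \<inter> \<Omega> \<noteq> {}" by blast
  moreover have "cball x r - \<Omega> \<noteq> {}" using sub by blast
  ultimately have "cball x r \<inter> frontier \<Omega> \<noteq> {}"
    by (intro connected_Int_frontier connected_cball)
  then show ?thesis using that by blast
next
  case False
  then have "x \<in> frontier \<Omega>" using assms(1) x by (simp add: frontier_def interior_open)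
  then show ?thesis using that assms(3) by simp
qed

theorem mainTheorem1:
  fixes \<Omega> :: "(real ^ 'n) set" and u v :: "real ^ 'n \<Rightarrow> real"
  assumes "is_domain \<Omega>" and "bounded \<Omega>"
    and "continuous_on (closure \<Omega>) u" and "continuous_on (closure \<Omega>) v"
    and "infinity_subharmonic_on \<Omega> u"
    and "infinity_superharmonic_on \<Omega> v"
  shows "\<exists>m. is_max_on (closure \<Omega>) (\<lambda>x. u x - v x) m \<and>
             is_max_on (frontier \<Omega>) (\<lambda>x. u x - v x) m"
proof -
  define K where "K = closure \<Omega>"
  define w where "w x = - v x" for x
  have op: "open \<Omega>" and ne: "\<Omega> \<noteq> {}" using assms(1) by (auto simp: is_domain_def)
  have K: "compact K" using assms(2) by (simp add: K_def)
  have sub: "\<Omega> \<subseteq> K" "frontier \<Omega> \<subseteq> K" by (auto simp: K_def closure_subset frontier_def)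
  have uK: "continuous_on K u" and wK: "continuous_on K w"
    using assms(3,4) by (auto simp: K_def w_def intro!: continuous_intros)
  have ur: "radially_subharmonic_on \<Omega> u"
    using subharmonic_imp_radially_subharmonic assms(5) .
  have wr: "radially_subharmonic_on \<Omega> w"
    unfolding w_def using superharmonic_imp_radially_subharmonic_uminus assms(6) .
  have cont: "continuous_on K (\<lambda>x. u x + w x)" by (intro continuous_intros uK wK)
  have "\<Omega> \<noteq> UNIV" using assms(2) not_bounded_UNIV by blast
  then have "frontier \<Omega> \<noteq> {}" using ne frontier_eq_empty by blast
  moreover have "compact (frontier \<Omega>)" using assms(2) by (rule compact_frontier_bounded)
  ultimately obtain q where q: "q \<in> frontier \<Omega>" "\<And>p. p \<in> frontier \<Omega> \<Longrightarrow> u p + w p \<le> u q + w q"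
    using continuous_attains_sup[OF _ _ continuous_on_subset[OF cont sub(2)]] by blast
  obtain xs where xs: "xs \<in> K" "\<And>x. x \<in> K \<Longrightarrow> u x + w x \<le> u xs + w xs"
    using continuous_attains_sup[OF K _ cont] ne sub(1) by blast
  have "u xs + w xs \<le> u q + w q"
  proof (rule ccontr)
    assume contra: "\<not> ?thesis"
    \<comment> \<open>Half of the excess, because \<open>u\<close> and \<open>w\<close> may each vary by \<open>\<delta>\<close>.\<close>
    define \<delta> where "\<delta> = (u xs + w xs - (u q + w q)) / 2"
    have \<delta>: "\<delta> > 0" using contra by (simp add: \<delta>_def)
    obtain d1 where d1: "d1 > 0" "\<And>a b. a \<in> K \<Longrightarrow> b \<in> K \<Longrightarrow> dist b a < d1 \<Longrightarrow> dist (u b) (u a) < \<delta>"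
      using compact_uniformly_continuous[OF uK K] \<delta> unfolding uniformly_continuous_on_def by metis
    obtain d2 where d2: "d2 > 0" "\<And>a b. a \<in> K \<Longrightarrow> b \<in> K \<Longrightarrow> dist b a < d2 \<Longrightarrow> dist (w b) (w a) < \<delta>"
      using compact_uniformly_continuous[OF wK K] \<delta> unfolding uniformly_continuous_on_def by metis
    \<comment> \<open>A boundary point within \<open>2 r\<close> of \<open>x\<close> is within \<open>3 r\<close> of all points of the \<open>r\<close>-ball around \<open>x\<close>.\<close>
    define r where "r = min d1 d2 / 4"
    have r: "r > 0" "3 * r < d1" "3 * r < d2" using d1(1) d2(1) by (auto simp: r_def)
    have inside: "cball x (2 * r) \<subseteq> \<Omega>"
      if x: "x \<in> K" and ab: "a \<in> K \<inter> cball x r" "b \<in> K \<inter> cball x r"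
        and large: "u xs + w xs \<le> u a + w b" for x a b
    proof (rule ccontr)
      assume "\<not> cball x (2 * r) \<subseteq> \<Omega>"
      then obtain p where p: "p \<in> frontier \<Omega>" "p \<in> cball x (2 * r)"
        using frontier_point_in_cball[OF op, of x "2 * r"] x r(1) unfolding K_def by auto
      have near: "dist c p \<le> 3 * r" if "c \<in> cball x r" for c
        using that p(2) dist_triangle[of c p x] by (simp add: dist_commute)
      have "dist (u a) (u p) < \<delta>" "dist (w b) (w p) < \<delta>"
        using d1(2)[of p a] d2(2)[of p b] near[of a] near[of b] ab p(1) sub(2) r by auto
      then have "u a + w b < u p + w p + 2 * \<delta>" by (auto simp: dist_real_def)
      then show False using q(2)[OF p(1)] large by (simp add: \<delta>_def field_simps)
    qed
    \<comment> \<open>The points at which both suprema only involve values on the closure, where continuity is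
       known.\<close>
    define C where "C = {x. cball x r \<subseteq> K}"
    have CK: "C \<subseteq> K" using r(1) by (auto simp: C_def)
    have inC: "cball x r \<subseteq> C" if "cball x (2 * r) \<subseteq> \<Omega>" for x
    proof
      fix y assume "y \<in> cball x r"
      then have "cball y r \<subseteq> cball x (2 * r)" using cball_trans by fastforce
      then show "y \<in> C" using that sub(1) by (auto simp: C_def)
    qed
    have "cball xs (2 * r) \<subseteq> \<Omega>" using inside[of xs xs xs] xs(1) r(1) by simp
    then have xsC: "xs \<in> C" using inC r(1) by (meson centre_in_cball less_imp_le subsetD)
    have cballs: "continuous_on (cball x r) u" "continuous_on (cball x r) w" if "x \<in> C" for x
      using that uK wK continuous_on_subset unfolding C_def by blast+
    have C: "compact C"
      unfolding C_def using K r(1) by (intro compact_inner_parallel_set) auto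
    have CA: "continuous_on C (sup_ball r u)" "continuous_on C (sup_ball r w)"
      unfolding C_def using K r(1) uK wK by (auto intro!: continuous_on_sup_ball)
    obtain x where x: "x \<in> C"
      "\<And>y. y \<in> C \<Longrightarrow> sup_ball r u y + sup_ball r w y \<le> sup_ball r u x + sup_ball r w x"
      "\<not> (cball x r \<subseteq> C \<and> discretely_subharmonic_at r (sup_ball r u) x
         \<and> discretely_subharmonic_at r (sup_ball r w) x)"
      using discrete_maximum_principle[OF C _ CA r(1)] xsC by blast
    obtain a where a: "a \<in> cball x r" "sup_ball r u x = u a"
      using sup_ball_attained[OF cballs(1)[OF x(1)]] r(1) by (metis less_imp_le)
    obtain b where b: "b \<in> cball x r" "sup_ball r w x = w b"
      using sup_ball_attained[OF cballs(2)[OF x(1)]] r(1) by (metis less_imp_le)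
    have "u xs + w xs \<le> sup_ball r u xs + sup_ball r w xs"
      using le_sup_ball[OF cballs(1)[OF xsC]] le_sup_ball[OF cballs(2)[OF xsC]] r(1)
      by (intro add_mono) auto
    also have "\<dots> \<le> u a + w b" using x(2)[OF xsC] a(2) b(2) by simp
    finally have ins: "cball x (2 * r) \<subseteq> \<Omega>"
      using inside[of x a b] a(1) b(1) x(1) CK unfolding C_def by blast
    have "discretely_subharmonic_at r (sup_ball r u) x" "discretely_subharmonic_at r (sup_ball r w) x"
      using discretely_subharmonic_sup_ball[OF ur _ ins r(1)]
        discretely_subharmonic_sup_ball[OF wr _ ins r(1)]
        continuous_on_subset[OF uK sub(1)] continuous_on_subset[OF wK sub(1)] by blast+
    then show False using x(3) inC[OF ins] by blast
  qed
  then have "u x - v x \<le> u q - v q" if "x \<in> K" for x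
    using xs(2)[OF that] by (simp add: w_def)
  then have "is_max_on K (\<lambda>x. u x - v x) (u q - v q)" "is_max_on (frontier \<Omega>) (\<lambda>x. u x - v x) (u q - v q)"
    using q(1) sub(2) unfolding is_max_on_def by auto
  then show ?thesis unfolding K_def by blast
qed

end
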